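(* Let $G$ be a graph with $n$ vertices, let $k \in \{0, \ldots, n\}$ be such that $\mathrm{MD}_k(G) \ge k$, and choose any pair of integers $r$ and $s$ such that $r \ge k$, $s \ge k$, and $r+s = n - \mathrm{MD}_k(G) + k$. Then there exists a matrix $A \in \mathcal{S}(G)$ such that $\operatorname{pin}(A) = (r,s)$.
   Context: All graphs are finite, simple and undirected. For a graph $G=(V,E)$ with vertex set $V=\{1,\ldots,n\}$, $\mathcal{S}(G)$ is the set of all real symmetric $n\times n$ matrices $A=[a_{ij}]$ such that for $i\neq j$, $a_{ij}\neq 0$ if and only if $ij\in E$ (no condition on the diagonal entries). The partial inertia of a Hermitian matrix $A$ is $\operatorname{pin}(A)=(\pi(A),\nu(A))$, where $\pi(A)$ and $\nu(A)$ are the numbers of positive and of negative eigenvalues of $A$, counted with multiplicity. For a graph $G$ on $n$ vertices and $k\in\{0,\ldots,n\}$, the maximal disconnection $\mathrm{MD}_k(G)$ is the maximum, over all induced subgraphs $F$ of $G$ having $n-k$ vertices, of the number of connected components of $F$ (the graph with no vertices has $0$ components). *)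

theory Defs
  imports "Graph_Theory.Digraph_Component" "Jordan_Normal_Form.Char_Poly"
begin

text \<open>
  A finite simple undirected graph is a \<^locale>\<open>pair_graph\<close>: finite, loop-free, and with a
  symmetric arc relation, the edge \<open>ij\<close> being the two arcs \<open>(i, j)\<close> and \<open>(j, i)\<close>. Vertices are
  numbered \<open>0, \<dots>, n - 1\<close> rather than \<open>1, \<dots>, n\<close>, to agree with matrix indices.
\<close>

definition simple_graph_on :: "nat \<Rightarrow> nat pair_pre_digraph \<Rightarrow> bool" where
  "simple_graph_on n G \<longleftrightarrow> pair_graph G \<and> pverts G = {0..<n}"

definition sym_matrices :: "nat pair_pre_digraph \<Rightarrow> real mat set" where
  "sym_matrices G = (let n = card (pverts G) in
     {A \<in> carrier_mat n n. transpose_mat A = A \<and>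
        (\<forall>i<n. \<forall>j<n. i \<noteq> j \<longrightarrow> (A $$ (i, j) \<noteq> 0 \<longleftrightarrow> (i, j) \<in> parcs G))})"

text \<open>
  The multiplicity of an eigenvalue is its multiplicity as a root of the characteristic
  polynomial. For symmetric matrices all complex eigenvalues are real, and this
  multiplicity is also the dimension of the eigenspace.
\<close>

definition num_pos_eigenvalues :: "real mat \<Rightarrow> nat" where
  "num_pos_eigenvalues A = (\<Sum>x | eigenvalue A x \<and> x > 0. Polynomial.order x (char_poly A))"

definition num_neg_eigenvalues :: "real mat \<Rightarrow> nat" where
  "num_neg_eigenvalues A = (\<Sum>x | eigenvalue A x \<and> x < 0. Polynomial.order x (char_poly A))"

definition pin :: "real mat \<Rightarrow> nat \<times> nat" where
  "pin A = (num_pos_eigenvalues A, num_neg_eigenvalues A)"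

text \<open>
  For a symmetric arc relation, strongly connected components are the connected components.
  They are nonempty by definition, so the graph without vertices has none.
\<close>

definition num_components :: "('a, 'b) pre_digraph \<Rightarrow> nat" where
  "num_components F = card (pre_digraph.sccs F)"

text \<open>
  Meaningful for \<open>k \<le> card (pverts G)\<close> only (subtraction on \<^typ>\<open>nat\<close> is truncated).
\<close>

definition max_disconnection :: "nat \<Rightarrow> 'a pair_pre_digraph \<Rightarrow> nat" where
  "max_disconnection k G =
     Max {num_components F | F. induced_subgraph F (with_proj G) \<and>
                                card (verts F) = card (pverts G) - k}"

end

theory Submission
  imports Defs "Jordan_Normal_Form.Spectral_Radius"
begin

text \<open>
  Let \<open>F\<close> be an induced subgraph on a set \<open>W\<close> of \<open>n - k\<close> vertices with \<open>c = MD\<^sub>k\<close> components.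
  Choose a rooted spanning forest of \<open>F\<close>; it has \<open>n - k - c = (r - k) + (s - k)\<close> edges, one from
  each vertex that is not a root to its parent. Give every edge of \<open>F\<close> the weight \<open>1\<close> and add a large
  number \<open>K\<close> to the weight of at most \<open>r - k\<close> forest edges, called positive, and \<open>- K\<close> to that of the
  others, called negative, at most \<open>s - k\<close> in number. Take the weighted Laplacian on \<open>W\<close>, and put entries \<open>1\<close> at
  the edges that meet the complement of \<open>W\<close>. On vectors \<open>x\<close> that vanish outside \<open>W\<close>, the quadratic
  form is the sum of weight times \<open>(x\<^sub>u - x\<^sub>v)\<^sup>2\<close> over the edges of \<open>F\<close>. If moreover the differences along
  the positive forest edges vanish, every other difference along an edge is controlled by the
  negative forest edges, because both ends have the same root; so the form is nonpositive
  for large \<open>K\<close>. These are \<open>k + (r - k)\<close> linear conditions, whence at most \<open>r\<close> positive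
  eigenvalues; in the same way there are at most \<open>s\<close> negative ones (\<open>forest_matrix_inertia\<close>).

  It remains to reach \<open>(r, s)\<close> exactly. Since \<open>c \<ge> k\<close>, we have \<open>r + s \<le> n\<close>, so a matrix whose
  partial inertia is not yet \<open>(r, s)\<close> is singular. Adding \<open>1\<close> to a diagonal entry at which some null
  vector does not vanish raises the number of positive eigenvalues by one and keeps the number
  of negative ones; subtracting \<open>1\<close> does the reverse (\<open>inertia_add_diagonal\<close>). Diagonal entries
  are free, so repeating this leads to \<open>(r, s)\<close> (\<open>inertia_increase_diagonal\<close>).

  Eigenvalues are counted through an orthonormal basis of eigenvectors
  (\<open>eigenbasis_exists\<close>, \<open>pin_eigenbasis\<close>), and all bounds on their numbers come from one fact of
  linear algebra, that fewer equations than unknowns have a nontrivial solution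
  (\<open>nontrivial_solution\<close>). Vectors and matrices are functions on \<^typ>\<open>nat\<close> of which only
  the values below \<open>n\<close> matter.
\<close>

section \<open>Homogeneous linear equations and orthonormal families\<close>

text \<open>
  Gaussian elimination: an equation with a nonzero coefficient is used to eliminate one unknown,
  which leaves one equation and one unknown less.
\<close>

lemma nontrivial_solution:
  fixes c :: "'j \<Rightarrow> 'a \<Rightarrow> real"
  assumes "finite J" "finite S" "card J < card S"
  shows "\<exists>y. (\<exists>t\<in>S. y t \<noteq> 0) \<and> (\<forall>j\<in>J. (\<Sum>t\<in>S. c j t * y t) = 0)"
  using assms
proof (induction J arbitrary: S c rule: finite_induct)
  case empty
  then have "S \<noteq> {}" by auto
  then show ?case by (intro exI[of _ "\<lambda>_. 1"]) auto
next
  case (insert j J)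
  show ?case
  proof (cases "\<forall>t\<in>S. c j t = 0")
    case True
    obtain y where "\<exists>t\<in>S. y t \<noteq> 0" "\<forall>i\<in>J. (\<Sum>t\<in>S. c i t * y t) = 0"
      using insert.IH[of S c] insert.prems insert.hyps by auto
    then show ?thesis using True by (intro exI[of _ y]) auto
  next
    case False
    then obtain s where s: "s \<in> S" "c j s \<noteq> 0" by auto
    define S' where "S' = S - {s}"
    have S': "finite S'" "s \<notin> S'" "S = insert s S'"
      using s insert.prems by (auto simp: S'_def)
    have "card J < card S'" using S' insert.prems insert.hyps by simp
    from insert.IH[OF S'(1) this, of "\<lambda>i t. c i t - c i s * c j t / c j s"]
    obtain y where y: "\<exists>t\<in>S'. y t \<noteq> 0"
      "\<forall>i\<in>J. (\<Sum>t\<in>S'. (c i t - c i s * c j t / c j s) * y t) = 0" by blast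
    define z where "z = y(s := - (\<Sum>t\<in>S'. c j t * y t) / c j s)"
    have sum: "(\<Sum>t\<in>S. c i t * z t) = c i s * z s + (\<Sum>t\<in>S'. c i t * y t)" for i
    proof -
      have "(\<Sum>t\<in>S'. c i t * z t) = (\<Sum>t\<in>S'. c i t * y t)"
        using S'(2) by (intro sum.cong) (auto simp: z_def)
      then show ?thesis using S' by simp
    qed
    have "(\<Sum>t\<in>S. c i t * z t) = 0" if "i \<in> J" for i
    proof -
      have "0 = (\<Sum>t\<in>S'. c i t * y t - c i s / c j s * (c j t * y t))"
        using y(2) that by (simp add: field_simps)
      also have "\<dots> = (\<Sum>t\<in>S'. c i t * y t) - c i s / c j s * (\<Sum>t\<in>S'. c j t * y t)"
        by (simp add: sum_subtractf sum_distrib_left)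
      finally show ?thesis unfolding sum by (simp add: z_def)
    qed
    moreover have "(\<Sum>t\<in>S. c j t * z t) = 0"
      unfolding sum using s by (simp add: z_def)
    moreover have "\<exists>t\<in>S. z t \<noteq> 0" using y(1) S' by (auto simp: z_def)
    ultimately show ?thesis by blast
  qed
qed

definition dot :: "nat \<Rightarrow> (nat \<Rightarrow> real) \<Rightarrow> (nat \<Rightarrow> real) \<Rightarrow> real" where
  "dot n x y = (\<Sum>i<n. x i * y i)"

definition act :: "nat \<Rightarrow> (nat \<Rightarrow> nat \<Rightarrow> real) \<Rightarrow> (nat \<Rightarrow> real) \<Rightarrow> nat \<Rightarrow> real" where
  "act n a x i = (\<Sum>j<n. a i j * x j)"

text \<open>
  The number \<open>m\<close> of vectors is kept apart from their length \<open>n\<close>: eigenbases are built one vector at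
  a time.
\<close>

definition orthonormal :: "nat \<Rightarrow> (nat \<Rightarrow> nat \<Rightarrow> real) \<Rightarrow> nat \<Rightarrow> bool" where
  "orthonormal n q m \<longleftrightarrow> (\<forall>s<m. \<forall>t<m. dot n (q s) (q t) = (if s = t then 1 else 0))"

definition symmetric_on :: "nat \<Rightarrow> (nat \<Rightarrow> nat \<Rightarrow> real) \<Rightarrow> bool" where
  "symmetric_on n a \<longleftrightarrow> (\<forall>i<n. \<forall>j<n. a i j = a j i)"

definition eigenbasis ::
  "nat \<Rightarrow> (nat \<Rightarrow> nat \<Rightarrow> real) \<Rightarrow> (nat \<Rightarrow> nat \<Rightarrow> real) \<Rightarrow> (nat \<Rightarrow> real) \<Rightarrow> bool" where
  "eigenbasis n a q d \<longleftrightarrow>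
     orthonormal n q n \<and> (\<forall>t<n. \<forall>i<n. act n a (q t) i = d t * q t i)"

lemma dot_commute: "dot n x y = dot n y x"
  by (simp add: dot_def mult.commute)

lemma dot_sum_left: "dot n (\<lambda>i. \<Sum>t\<in>S. y t * q t i) x = (\<Sum>t\<in>S. y t * dot n (q t) x)"
proof -
  have "dot n (\<lambda>i. \<Sum>t\<in>S. y t * q t i) x = (\<Sum>i<n. \<Sum>t\<in>S. y t * (q t i * x i))"
    by (simp add: dot_def sum_distrib_right mult.assoc)
  also have "\<dots> = (\<Sum>t\<in>S. \<Sum>i<n. y t * (q t i * x i))" by (rule sum.swap)
  finally show ?thesis by (simp add: dot_def sum_distrib_left)
qed

lemma dot_scale_left: "dot n (\<lambda>i. c * x i) y = c * dot n x y"
  by (simp add: dot_def sum_distrib_left mult.assoc)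

lemma dot_cong: "(\<And>i. i < n \<Longrightarrow> x i = x' i) \<Longrightarrow> (\<And>i. i < n \<Longrightarrow> y i = y' i) \<Longrightarrow> dot n x y = dot n x' y'"
  by (simp add: dot_def)

lemma dot_self_eq_0_iff: "dot n x x = 0 \<longleftrightarrow> (\<forall>i<n. x i = 0)"
  by (auto simp: dot_def sum_nonneg_eq_0_iff)

lemma dot_self_nonneg: "dot n x x \<ge> 0"
  by (simp add: dot_def sum_nonneg)

lemma act_symmetric:
  assumes "symmetric_on n a"
  shows "dot n x (act n a y) = dot n (act n a x) y"
proof -
  have "dot n x (act n a y) = (\<Sum>i<n. \<Sum>j<n. x i * (a i j * y j))"
    by (simp add: dot_def act_def sum_distrib_left)
  also have "\<dots> = (\<Sum>j<n. \<Sum>i<n. x i * (a i j * y j))" by (rule sum.swap)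
  also have "\<dots> = (\<Sum>j<n. \<Sum>i<n. a j i * x i * y j)"
    using assms by (intro sum.cong refl) (auto simp: symmetric_on_def)
  finally show ?thesis by (simp add: dot_def act_def sum_distrib_right)
qed

lemma act_cong: "(\<And>j. j < n \<Longrightarrow> x j = x' j) \<Longrightarrow> act n a x i = act n a x' i"
  by (simp add: act_def)

lemma act_sum: "act n a (\<lambda>i. \<Sum>t\<in>S. y t * q t i) i = (\<Sum>t\<in>S. y t * act n a (q t) i)"
  using dot_sum_left[where n = n and S = S and y = y and q = q and x = "a i"]
  by (simp add: act_def dot_def mult.commute)

lemma orthonormalD:
  "orthonormal n q m \<Longrightarrow> s < m \<Longrightarrow> t < m \<Longrightarrow> dot n (q s) (q t) = (if s = t then 1 else 0)"
  by (simp add: orthonormal_def)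

lemma orthonormal_combination:
  assumes "orthonormal n q m" "S \<subseteq> {..<m}" "s < m"
  shows "dot n (\<lambda>i. \<Sum>t\<in>S. y t * q t i) (q s) = (if s \<in> S then y s else 0)"
proof -
  have fin: "finite S" using assms(2) finite_subset by blast
  have "dot n (\<lambda>i. \<Sum>t\<in>S. y t * q t i) (q s) = (\<Sum>t\<in>S. if t = s then y t else 0)"
    unfolding dot_sum_left using assms
    by (intro sum.cong) (auto simp: orthonormalD subset_iff)
  also have "\<dots> = (if s \<in> S then y s else 0)" using fin by simp
  finally show ?thesis .
qed

text \<open>
  The \<open>n + 1\<close> vectors \<open>q\<^sub>0, \<dots>, q\<^sub>n\<^sub>-\<^sub>1, x\<close> satisfy a nontrivial linear relation, and pairing it
  with each of these pairwise orthogonal vectors forces \<open>x\<close> to vanish.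
\<close>

lemma orthonormal_complete:
  assumes q: "orthonormal n q n" and x: "\<And>t. t < n \<Longrightarrow> dot n x (q t) = 0" and "i < n"
  shows "x i = 0"
proof -
  define p where "p = q(n := x)"
  have "\<exists>y. (\<exists>t\<in>{..n}. y t \<noteq> 0) \<and> (\<forall>i\<in>{..<n}. (\<Sum>t\<in>{..n}. p t i * y t) = 0)"
    by (rule nontrivial_solution) auto
  then obtain y where y: "\<exists>t\<le>n. y t \<noteq> 0" and 0: "\<And>i. i < n \<Longrightarrow> (\<Sum>t\<le>n. y t * p t i) = 0"
    by (auto simp: mult.commute)
  have "dot n (\<lambda>i. \<Sum>t\<le>n. y t * p t i) z = 0" for z using 0 by (simp add: dot_def)
  then have sum: "(\<Sum>t\<le>n. y t * dot n (p t) z) = 0" for z unfolding dot_sum_left .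
  have p: "dot n (p t) (p s) = (if t = s then if t = n then dot n x x else 1 else 0)"
    if "t \<le> n" "s \<le> n" for t s
    using that q x by (auto simp: p_def orthonormal_def dot_commute)
  have yd: "y s * (if s = n then dot n x x else 1) = 0" if "s \<le> n" for s
  proof -
    have "(\<Sum>t\<le>n. y t * dot n (p t) (p s))
      = (\<Sum>t\<le>n. if t = s then y s * (if s = n then dot n x x else 1) else 0)"
      using that by (intro sum.cong) (auto simp: p)
    then show ?thesis using sum[of "p s"] that by (simp add: sum.delta)
  qed
  have "y s = 0" if "s < n" for s using yd[of s] that by simp
  with y have "y n \<noteq> 0" by (metis le_neq_implies_less)
  with yd[of n] have "dot n x x = 0" by simp
  with \<open>i < n\<close> show ?thesis by (simp add: dot_self_eq_0_iff)
qed

lemma orthonormal_expansion: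
  assumes q: "orthonormal n q n" and "i < n"
  shows "x i = (\<Sum>t<n. dot n x (q t) * q t i)"
proof -
  let ?e = "\<lambda>i. \<Sum>t<n. dot n x (q t) * q t i"
  have "dot n (\<lambda>i. x i - ?e i) (q s) = 0" if "s < n" for s
  proof -
    have "dot n (\<lambda>i. x i - ?e i) (q s) = dot n x (q s) - dot n ?e (q s)"
      by (simp add: dot_def left_diff_distrib sum_subtractf)
    then show ?thesis using orthonormal_combination[OF q _ that] that by simp
  qed
  from orthonormal_complete[OF q this \<open>i < n\<close>] show ?thesis by simp
qed

lemma orthonormal_extend1:
  assumes q: "orthonormal n q m" and x: "\<And>t. t < m \<Longrightarrow> dot n x (q t) = 0"
    and x0: "\<exists>i<n. x i \<noteq> 0"
  shows "orthonormal n (q(m := \<lambda>i. x i / sqrt (dot n x x))) (Suc m)"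
proof -
  define c where "c = 1 / sqrt (dot n x x)"
  have "dot n x x \<noteq> 0" using x0 by (auto simp: dot_self_eq_0_iff)
  with dot_self_nonneg[of n x] have pos: "dot n x x > 0" by simp
  define u where "u = (\<lambda>i. c * x i)"
  have u: "(\<lambda>i. x i / sqrt (dot n x x)) = u" by (simp add: u_def c_def)
  have "dot n u u = c * (c * dot n x x)"
    by (simp add: u_def dot_scale_left dot_commute[of n x "\<lambda>i. c * x i"])
  then have uu: "dot n u u = 1" using pos by (simp add: c_def)
  have "dot n u (q t) = 0" "dot n (q t) u = 0" if "t < m" for t
    using x that dot_commute[of n "q t" u] by (simp_all add: u_def dot_scale_left)
  with uu q show ?thesis
    unfolding u by (auto simp: orthonormal_def less_Suc_eq)
qed

lemma orthonormal_extend: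
  assumes "orthonormal n q m" "m \<le> n"
  shows "\<exists>p. orthonormal n p n \<and> (\<forall>t<m. p t = q t)"
  using assms(2,1)
proof (induction m arbitrary: q rule: inc_induct)
  case base
  then show ?case by blast
next
  case (step m)
  have "\<exists>x. (\<exists>i\<in>{..<n}. x i \<noteq> 0) \<and> (\<forall>t\<in>{..<m}. (\<Sum>i\<in>{..<n}. q t i * x i) = 0)"
    by (rule nontrivial_solution) (use step in auto)
  then obtain x where x: "\<exists>i<n. x i \<noteq> 0" "\<And>t. t < m \<Longrightarrow> dot n x (q t) = 0"
    by (auto simp: dot_def mult.commute)
  from step.IH[OF orthonormal_extend1[OF step.prems x(2,1)]]
  obtain p where "orthonormal n p n" "\<forall>t<Suc m. p t = (q(m := \<lambda>i. x i / sqrt (dot n x x))) t"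
    by blast
  then show ?case by (intro exI[of _ p]) auto
qed

text \<open>
  A complex eigenvector \<open>z\<close> exists. The number \<open>z\<^sup>* b z\<close> is real because \<open>b\<close> is symmetric, so the
  eigenvalue is real, and the real or the imaginary part of \<open>z\<close> is an eigenvector.
\<close>

lemma symmetric_real_eigenvector:
  assumes sym: "symmetric_on m b" and "m > 0"
  shows "\<exists>e y. (\<exists>i<m. y i \<noteq> 0) \<and> (\<forall>i<m. act m b y i = e * y i)"
proof -
  define B where "B = mat m m (\<lambda>(i, j). complex_of_real (b i j))"
  have B: "B \<in> carrier_mat m m" by (simp add: B_def)
  obtain l where "eigenvalue B l"
    using spectrum_non_empty[OF B \<open>m > 0\<close>] by (auto simp: spectrum_def)
  then obtain z where "eigenvector B z l" by (auto simp: eigenvalue_def)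
  then have z: "z \<in> carrier_vec m" "z \<noteq> 0\<^sub>v m" "B *\<^sub>v z = l \<cdot>\<^sub>v z"
    using B by (auto simp: eigenvector_def)
  have eq: "(\<Sum>j<m. of_real (b i j) * z $ j) = l * z $ i" if "i < m" for i
  proof -
    have "(B *\<^sub>v z) $ i = (\<Sum>j<m. of_real (b i j) * z $ j)"
      using that z(1) B by (simp add: B_def scalar_prod_def lessThan_atLeast0)
    then show ?thesis using z that by simp
  qed
  have "\<exists>i<m. z $ i \<noteq> 0" using z by (metis carrier_vecD eq_vecI index_zero_vec(1,2))
  then obtain k where k: "k < m" "z $ k \<noteq> 0" by auto
  define N where "N = (\<Sum>i<m. (cmod (z $ i))\<^sup>2)"
  have "N > 0" unfolding N_def by (rule sum_pos2[of _ k]) (use k in auto)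
  define w where "w = (\<Sum>i<m. \<Sum>j<m. cnj (z $ i) * (of_real (b i j) * z $ j))"
  have "w = (\<Sum>i<m. cnj (z $ i) * (l * z $ i))"
    unfolding w_def by (intro sum.cong) (auto simp: sum_distrib_left[symmetric] eq)
  also have "\<dots> = l * of_real N"
    by (simp add: N_def sum_distrib_left complex_norm_square mult_ac flip: of_real_power)
  finally have w: "w = l * of_real N" .
  have "cnj w = (\<Sum>i<m. \<Sum>j<m. z $ i * (of_real (b i j) * cnj (z $ j)))"
    by (simp add: w_def)
  also have "\<dots> = (\<Sum>j<m. \<Sum>i<m. z $ i * (of_real (b i j) * cnj (z $ j)))" by (rule sum.swap)
  also have "\<dots> = w"
    unfolding w_def using sym by (intro sum.cong refl) (auto simp: symmetric_on_def mult_ac)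
  finally have "cnj l = l" using w \<open>N > 0\<close> by simp
  then have l: "l = of_real (Re l)" by (metis complex_eq_iff Im_complex_of_real Re_complex_of_real cnj.simps(2) neg_equal_zero)
  have re: "act m b (\<lambda>i. Re (z $ i)) i = Re l * Re (z $ i)"
    and im: "act m b (\<lambda>i. Im (z $ i)) i = Re l * Im (z $ i)" if "i < m" for i
    using arg_cong[OF eq[OF that], of Re] arg_cong[OF eq[OF that], of Im] l
    by (auto simp: act_def) (metis Im_complex_of_real)+
  from k consider "Re (z $ k) \<noteq> 0" | "Im (z $ k) \<noteq> 0" by (auto simp: complex_eq_iff)
  then show ?thesis
  proof cases
    case 1
    show ?thesis by (rule exI[of _ "Re l"], rule exI[of _ "\<lambda>i. Re (z $ i)"]) (use 1 re k in auto)
  next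
    case 2
    show ?thesis by (rule exI[of _ "Re l"], rule exI[of _ "\<lambda>i. Im (z $ i)"]) (use 2 im k in auto)
  qed
qed

section \<open>Orthonormal eigenbases and the characteristic polynomial\<close>

lemma act_scale: "act n a (\<lambda>i. c * x i) i = c * act n a x i"
  by (simp add: act_def sum_distrib_left mult_ac)

text \<open>
  The orthogonal complement of the eigenvectors found so far is invariant. Completing them to an
  orthonormal basis \<open>p\<close>, the restriction of \<open>a\<close> to the complement is the symmetric matrix \<open>b\<close> below,
  and an eigenvector of \<open>b\<close> is the coordinate vector of an eigenvector of \<open>a\<close>.
\<close>

lemma eigenbasis_step:
  assumes sym: "symmetric_on n a" and "m < n" and q: "orthonormal n q m"
    and eig: "\<And>t i. t < m \<Longrightarrow> i < n \<Longrightarrow> act n a (q t) i = d t * q t i"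
  shows "\<exists>x e. (\<exists>i<n. x i \<noteq> 0) \<and> (\<forall>t<m. dot n x (q t) = 0) \<and> (\<forall>i<n. act n a x i = e * x i)"
proof -
  obtain p where p: "orthonormal n p n" and pq: "\<And>t. t < m \<Longrightarrow> p t = q t"
    using orthonormal_extend[OF q] \<open>m < n\<close> by auto
  define b where "b s t = dot n (p (m + s)) (act n a (p (m + t)))" for s t
  have "symmetric_on (n - m) b"
    unfolding symmetric_on_def b_def by (metis act_symmetric[OF sym] dot_commute)
  then obtain e y where y0: "\<exists>i<n - m. y i \<noteq> 0"
    and y: "\<And>i. i < n - m \<Longrightarrow> act (n - m) b y i = e * y i"
    using symmetric_real_eigenvector[of "n - m" b] \<open>m < n\<close> by auto
  define x where "x = (\<lambda>i. \<Sum>t\<in>{m..<n}. y (t - m) * p t i)"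
  have x: "dot n x (p s) = (if m \<le> s then y (s - m) else 0)" if "s < n" for s
  proof -
    have "{m..<n} \<subseteq> {..<n}" by auto
    from orthonormal_combination[OF p this \<open>s < n\<close>] show ?thesis
      using that by (simp add: x_def)
  qed
  have ax: "dot n (act n a x) (p s) = e * dot n x (p s)" if s: "s < n" for s
  proof (cases "m \<le> s")
    case False
    have "dot n (act n a x) (p s) = dot n x (act n a (p s))" by (simp add: act_symmetric[OF sym])
    also have "\<dots> = dot n x (\<lambda>i. d s * p s i)"
      using False eig pq by (intro dot_cong) auto
    also have "\<dots> = d s * dot n x (p s)" by (simp add: dot_scale_left dot_commute[of n x])
    finally show ?thesis using x[OF s] False by simp
  next
    case True
    have "act n a x = (\<lambda>i. \<Sum>t\<in>{m..<n}. y (t - m) * act n a (p t) i)"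
      unfolding x_def by (rule ext) (rule act_sum)
    then have "dot n (act n a x) (p s) = (\<Sum>t\<in>{m..<n}. y (t - m) * dot n (act n a (p t)) (p s))"
      by (simp only: dot_sum_left)
    also have "\<dots> = (\<Sum>t<n - m. y t * b (s - m) t)"
      unfolding sum.atLeastLessThan_shift_0[of _ m n] b_def
      using True by (simp add: dot_commute lessThan_atLeast0)
    also have "\<dots> = act (n - m) b y (s - m)" by (simp add: act_def mult.commute)
    finally show ?thesis using True s x[OF s] y[of "s - m"] by simp
  qed
  have "act n a x i = e * x i" if "i < n" for i
  proof -
    have "dot n (\<lambda>i. act n a x i - e * x i) (p s) = 0" if "s < n" for s
    proof -
      have "dot n (\<lambda>i. act n a x i - e * x i) (p s) = dot n (act n a x) (p s) - e * dot n x (p s)"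
        by (simp add: dot_def left_diff_distrib sum_subtractf sum_distrib_left mult.assoc)
      then show ?thesis using ax[OF that] by simp
    qed
    from orthonormal_complete[OF p this \<open>i < n\<close>] show ?thesis by simp
  qed
  moreover have "\<exists>i<n. x i \<noteq> 0"
  proof (rule ccontr)
    assume "\<not> (\<exists>i<n. x i \<noteq> 0)"
    then have "dot n x z = 0" for z by (simp add: dot_def)
    moreover obtain i where "i < n - m" "y i \<noteq> 0" using y0 by auto
    ultimately show False using x[of "m + i"] less_diff_conv[of i n m] by (simp add: add.commute)
  qed
  moreover have "dot n x (q t) = 0" if "t < m" for t
    using x[of t] that pq \<open>m < n\<close> by simp
  ultimately show ?thesis by blast
qed

lemma eigenbasis_exists:
  assumes sym: "symmetric_on n a"
  shows "\<exists>q d. eigenbasis n a q d"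
proof -
  have "\<exists>q d. orthonormal n q m \<and> (\<forall>t<m. \<forall>i<n. act n a (q t) i = d t * q t i)" if "m \<le> n" for m
    using that
  proof (induction m)
    case 0
    show ?case by (simp add: orthonormal_def)
  next
    case (Suc m)
    then obtain q d where q: "orthonormal n q m"
      and eig: "\<And>t i. t < m \<Longrightarrow> i < n \<Longrightarrow> act n a (q t) i = d t * q t i"
      by auto
    obtain x e where x0: "\<exists>i<n. x i \<noteq> 0" and xq: "\<And>t. t < m \<Longrightarrow> dot n x (q t) = 0"
      and xe: "\<And>i. i < n \<Longrightarrow> act n a x i = e * x i"
      using eigenbasis_step[OF sym _ q eig] Suc.prems by auto
    let ?q = "q(m := \<lambda>i. x i / sqrt (dot n x x))"
    have "act n a (\<lambda>i. x i / sqrt (dot n x x)) i = e * (x i / sqrt (dot n x x))" if "i < n" for i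
      using act_scale[of n a "1 / sqrt (dot n x x)" x i] xe[OF that] by simp
    then have "\<forall>t<Suc m. \<forall>i<n. act n a (?q t) i = (d(m := e)) t * ?q t i"
      using eig by (auto simp: less_Suc_eq)
    with orthonormal_extend1[OF q xq x0] show ?case by blast
  qed
  from this[of n] show ?thesis by (simp add: eigenbasis_def)
qed

lemma order_prod_linear_factors:
  "Polynomial.order x (\<Prod>a\<leftarrow>map d [0..<n]. [:- a, 1:]) = card {t. t < n \<and> d t = (x :: real)}"
proof (induction n)
  case (Suc n)
  have eq: "{t. t < Suc n \<and> d t = x} = (if d n = x then insert n {t. t < n \<and> d t = x} else {t. t < n \<and> d t = x})"
    by (auto simp: less_Suc_eq)
  have nz: "(\<Prod>a\<leftarrow>map d [0..<m]. [:- a, 1:]) \<noteq> 0" for m by (auto simp: prod_list_zero_iff)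
  have "(\<Prod>a\<leftarrow>map d [0..<Suc n]. [:- a, 1:]) = (\<Prod>a\<leftarrow>map d [0..<n]. [:- a, 1:]) * [:- d n, 1:]"
    by simp
  then have "Polynomial.order x (\<Prod>a\<leftarrow>map d [0..<Suc n]. [:- a, 1:])
    = card {t. t < n \<and> d t = x} + Polynomial.order x [:- d n, 1:]"
    using order_mult[of "\<Prod>a\<leftarrow>map d [0..<n]. [:- a, 1:]" "[:- d n, 1:]" x] nz[of "Suc n"] Suc.IH
    by simp
  then show ?case by (auto simp: eq order_linear')
qed simp

text \<open>
  The eigenbasis makes \<open>A\<close> similar to a diagonal matrix, so the characteristic polynomial is the
  product of the factors \<open>X - d\<^sub>t\<close> and each eigenvalue occurs among the \<open>d\<^sub>t\<close> as often as its
  multiplicity says.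
\<close>

lemma pin_eigenbasis:
  assumes A: "A \<in> carrier_mat n n" and qd: "eigenbasis n (\<lambda>i j. A $$ (i, j)) q d"
  shows "pin A = (card {t. t < n \<and> d t > 0}, card {t. t < n \<and> d t < 0})"
proof -
  define P where "P = mat n n (\<lambda>(i, t). q t i)"
  define D where "D = mat n n (\<lambda>(i, j). if i = j then d i else 0)"
  have carr: "P \<in> carrier_mat n n" "P\<^sup>T \<in> carrier_mat n n" "D \<in> carrier_mat n n"
    by (simp_all add: P_def D_def)
  have "P\<^sup>T * P = 1\<^sub>m n"
  proof (rule eq_matI)
    fix s t assume "s < dim_row (1\<^sub>m n :: real mat)" "t < dim_col (1\<^sub>m n :: real mat)"
    then have st: "s < n" "t < n" by simp_all
    then have "(P\<^sup>T * P) $$ (s, t) = dot n (q s) (q t)"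
      by (simp add: P_def scalar_prod_def dot_def lessThan_atLeast0)
    then show "(P\<^sup>T * P) $$ (s, t) = 1\<^sub>m n $$ (s, t)"
      using qd st by (simp add: eigenbasis_def orthonormal_def)
  qed (simp_all add: P_def)
  then have inv: "P * P\<^sup>T = 1\<^sub>m n" "P\<^sup>T * P = 1\<^sub>m n"
    using mat_mult_left_right_inverse carr by blast+
  have "A * P = P * D"
  proof (rule eq_matI)
    fix i t assume "i < dim_row (P * D)" "t < dim_col (P * D)"
    then have it: "i < n" "t < n" by (simp_all add: P_def D_def)
    have "(A * P) $$ (i, t) = act n (\<lambda>i j. A $$ (i, j)) (q t) i"
      using it A by (simp add: P_def scalar_prod_def act_def lessThan_atLeast0)
    also have "\<dots> = d t * q t i" using qd it by (simp add: eigenbasis_def)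
    also have "\<dots> = (\<Sum>j<n. if j = t then d t * q t i else 0)" using it by simp
    also have "\<dots> = (\<Sum>j<n. q j i * (if j = t then d j else 0))"
      by (intro sum.cong) auto
    also have "\<dots> = (P * D) $$ (i, t)"
      using it by (simp add: P_def D_def scalar_prod_def lessThan_atLeast0)
    finally show "(A * P) $$ (i, t) = (P * D) $$ (i, t)" .
  qed (use A in \<open>simp_all add: P_def D_def\<close>)
  then have "P * D * P\<^sup>T = A * (P * P\<^sup>T)"
    using assoc_mult_mat[OF A carr(1,2)] by simp
  then have "A = P * D * P\<^sup>T" using A inv by simp
  then have "similar_mat_wit A D P (P\<^sup>T)"
    using A carr inv by (intro similar_mat_witI) auto
  then have "char_poly A = char_poly D" by (intro char_poly_similar) (auto simp: similar_mat_def)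
  also have "\<dots> = (\<Prod>a\<leftarrow>diag_mat D. [:- a, 1:])"
    by (rule char_poly_upper_triangular[OF carr(3)]) (simp add: D_def upper_triangular_def)
  also have "diag_mat D = map d [0..<n]" by (simp add: diag_mat_def D_def)
  finally have cp: "char_poly A = (\<Prod>a\<leftarrow>map d [0..<n]. [:- a, 1:])" .
  have ev: "eigenvalue A x \<longleftrightarrow> (\<exists>t<n. x = d t)" for x
    unfolding eigenvalue_root_char_poly[OF A] cp by (auto simp: poly_prod_list prod_list_zero_iff image_iff)
  have count: "(\<Sum>x | eigenvalue A x \<and> R x. Polynomial.order x (char_poly A)) = card {t. t < n \<and> R (d t)}"
    for R :: "real \<Rightarrow> bool"
  proof -
    let ?S = "{t. t < n \<and> R (d t)}"
    have "card ?S = (\<Sum>x\<in>d ` ?S. card {t \<in> ?S. d t = x})"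
      using sum.image_gen[of ?S "\<lambda>_. 1 :: nat" d] by simp
    also have "d ` ?S = {x. eigenvalue A x \<and> R x}" by (auto simp: ev)
    also have "(\<Sum>x | eigenvalue A x \<and> R x. card {t \<in> ?S. d t = x})
      = (\<Sum>x | eigenvalue A x \<and> R x. Polynomial.order x (char_poly A))"
      unfolding cp order_prod_linear_factors by (intro sum.cong refl arg_cong[of _ _ card]) auto
    finally show ?thesis by simp
  qed
  show ?thesis unfolding pin_def num_pos_eigenvalues_def num_neg_eigenvalues_def by (simp only: count)
qed

section \<open>Bounding and adjusting the inertia\<close>

lemma form_eigenbasis:
  assumes "eigenbasis n a q d"
  shows "dot n x (act n a x) = (\<Sum>t<n. d t * (dot n x (q t))\<^sup>2)"
proof -
  have q: "orthonormal n q n" and eig: "\<And>t i. t < n \<Longrightarrow> i < n \<Longrightarrow> act n a (q t) i = d t * q t i"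
    using assms by (auto simp: eigenbasis_def)
  have "act n a x i = (\<Sum>t<n. dot n x (q t) * d t * q t i)" if "i < n" for i
  proof -
    have "act n a x i = act n a (\<lambda>i. \<Sum>t<n. dot n x (q t) * q t i) i"
      by (rule act_cong) (rule orthonormal_expansion[OF q])
    then show ?thesis using that by (simp add: act_sum eig mult.assoc)
  qed
  then have "dot n x (act n a x) = dot n (\<lambda>i. \<Sum>t<n. dot n x (q t) * d t * q t i) x"
    unfolding dot_commute[of n x] by (intro dot_cong) auto
  also have "\<dots> = (\<Sum>t<n. d t * (dot n x (q t))\<^sup>2)"
    unfolding dot_sum_left by (intro sum.cong refl) (simp add: dot_commute power2_eq_square)
  finally show ?thesis .
qed

text \<open>
  Dimension count behind all eigenvalue bounds: the span of the \<open>q\<^sub>t\<close> with \<open>t \<in> S\<close> meets the solution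
  space of fewer than \<open>card S\<close> linear equations nontrivially.
\<close>

lemma exists_vector_in_eigenspaces:
  assumes q: "orthonormal n q n" and S: "S \<subseteq> {..<n}" and J: "finite J" "card J < card S"
  shows "\<exists>v. (\<exists>t\<in>S. dot n v (q t) \<noteq> 0) \<and> (\<forall>t<n. t \<notin> S \<longrightarrow> dot n v (q t) = 0) \<and>
             (\<forall>j\<in>J. dot n (l j) v = 0)"
proof -
  have "finite S" using S finite_subset by blast
  then obtain y where y: "\<exists>t\<in>S. y t \<noteq> 0" "\<forall>j\<in>J. (\<Sum>t\<in>S. dot n (q t) (l j) * y t) = 0"
    using nontrivial_solution[OF J(1) _ J(2), of "\<lambda>j t. dot n (q t) (l j)"] by blast
  define v where "v = (\<lambda>i. \<Sum>t\<in>S. y t * q t i)"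
  have "dot n v (q t) = (if t \<in> S then y t else 0)" if "t < n" for t
    unfolding v_def by (rule orthonormal_combination[OF q S that])
  moreover have "dot n (l j) v = 0" if "j \<in> J" for j
    using y(2) that unfolding v_def dot_commute[of n "l j"] dot_sum_left by (simp add: mult.commute)
  moreover have "\<exists>t\<in>S. dot n v (q t) \<noteq> 0" using calculation(1) y(1) S by (metis lessThan_iff subsetD)
  ultimately show ?thesis by (intro exI[of _ v]) auto
qed

text \<open>
  Otherwise a nonzero combination of eigenvectors with positive eigenvalue would satisfy all the
  equations, although the form is positive there.
\<close>

lemma positive_eigenvalues_le:
  assumes qd: "eigenbasis n a q d" and "finite J"
    and form: "\<And>x. (\<And>j. j \<in> J \<Longrightarrow> dot n (l j) x = 0) \<Longrightarrow> dot n x (act n a x) \<le> 0"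
  shows "card {t. t < n \<and> d t > 0} \<le> card J"
proof (rule ccontr)
  assume "\<not> ?thesis"
  moreover have q: "orthonormal n q n" using qd by (simp add: eigenbasis_def)
  moreover define S where "S = {t. t < n \<and> d t > 0}"
  moreover have "S \<subseteq> {..<n}" by (auto simp: S_def)
  ultimately obtain v where v: "\<exists>t\<in>S. dot n v (q t) \<noteq> 0"
    "\<And>t. t < n \<Longrightarrow> t \<notin> S \<Longrightarrow> dot n v (q t) = 0" "\<And>j. j \<in> J \<Longrightarrow> dot n (l j) v = 0"
    using exists_vector_in_eigenspaces[OF q _ \<open>finite J\<close>, of S l] by auto
  obtain t where t: "t \<in> S" "dot n v (q t) \<noteq> 0" using v by auto
  have "0 < (\<Sum>t<n. d t * (dot n v (q t))\<^sup>2)"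
  proof (rule sum_pos2[of _ t])
    fix s assume "s \<in> {..<n}"
    then show "0 \<le> d s * (dot n v (q s))\<^sup>2" using v(2)[of s] by (cases "s \<in> S") (auto simp: S_def)
  qed (use t in \<open>auto simp: S_def\<close>)
  also have "\<dots> \<le> 0" using form[OF v(3)] form_eigenbasis[OF qd] by simp
  finally show False by simp
qed

lemma eigenbasis_uminus:
  assumes "eigenbasis n a q d"
  shows "eigenbasis n (\<lambda>i j. - a i j) q (\<lambda>t. - d t)"
  using assms by (simp add: eigenbasis_def act_def sum_negf)

lemma negative_eigenvalues_le:
  assumes qd: "eigenbasis n a q d" and "finite J"
    and form: "\<And>x. (\<And>j. j \<in> J \<Longrightarrow> dot n (l j) x = 0) \<Longrightarrow> dot n x (act n a x) \<ge> 0"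
  shows "card {t. t < n \<and> d t < 0} \<le> card J"
proof -
  have "dot n x (act n (\<lambda>i j. - a i j) x) = - dot n x (act n a x)" for x
    by (simp add: dot_def act_def sum_negf)
  then show ?thesis
    using positive_eigenvalues_le[OF eigenbasis_uminus[OF qd] \<open>finite J\<close>, of l] form by simp
qed

text \<open>
  The kernel is spanned by the eigenvectors with eigenvalue zero, and the equations have only the
  trivial solution in it.
\<close>

lemma zero_eigenvalues_le:
  assumes qd: "eigenbasis n a q d" and "finite J"
    and ker: "\<And>x i. (\<And>i. i < n \<Longrightarrow> act n a x i = 0) \<Longrightarrow> (\<And>j. j \<in> J \<Longrightarrow> dot n (l j) x = 0)
               \<Longrightarrow> i < n \<Longrightarrow> x i = 0"
  shows "card {t. t < n \<and> d t = 0} \<le> card J"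
proof (rule ccontr)
  assume "\<not> ?thesis"
  moreover have q: "orthonormal n q n" using qd by (simp add: eigenbasis_def)
  moreover define S where "S = {t. t < n \<and> d t = 0}"
  moreover have "S \<subseteq> {..<n}" by (auto simp: S_def)
  ultimately obtain v where v: "\<exists>t\<in>S. dot n v (q t) \<noteq> 0"
    "\<And>t. t < n \<Longrightarrow> t \<notin> S \<Longrightarrow> dot n v (q t) = 0" "\<And>j. j \<in> J \<Longrightarrow> dot n (l j) v = 0"
    using exists_vector_in_eigenspaces[OF q _ \<open>finite J\<close>, of S l] by auto
  have "act n a v i = 0" if "i < n" for i
  proof -
    have "act n a v i = (\<Sum>t<n. dot n v (q t) * act n a (q t) i)"
      unfolding act_sum[symmetric] by (rule act_cong) (rule orthonormal_expansion[OF q])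
    also have "\<dots> = 0"
      using that qd v(2) by (intro sum.neutral) (auto simp: eigenbasis_def S_def)
    finally show ?thesis .
  qed
  from ker[OF this v(3)] have "\<forall>i<n. v i = 0" by auto
  with v(1) show False by (simp add: dot_def)
qed

definition inertia :: "nat \<Rightarrow> (nat \<Rightarrow> nat \<Rightarrow> real) \<Rightarrow> nat \<Rightarrow> nat \<Rightarrow> bool" where
  "inertia n a p m \<longleftrightarrow> (\<exists>q d. eigenbasis n a q d \<and>
     card {t. t < n \<and> d t > 0} = p \<and> card {t. t < n \<and> d t < 0} = m)"

lemma inertia_uminus:
  assumes "inertia n a p m"
  shows "inertia n (\<lambda>i j. - a i j) m p"
proof -
  obtain q d where "eigenbasis n a q d"
    "card {t. t < n \<and> d t > 0} = p" "card {t. t < n \<and> d t < 0} = m"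
    using assms by (auto simp: inertia_def)
  then show ?thesis
    unfolding inertia_def by (intro exI[of _ q] exI[of _ "\<lambda>t. - d t"]) (simp add: eigenbasis_uminus)
qed

lemma card_signs:
  fixes d :: "nat \<Rightarrow> real"
  shows "card {t. t < n \<and> d t > 0} + card {t. t < n \<and> d t < 0} + card {t. t < n \<and> d t = 0} = n"
proof -
  have "{..<n} = ({t. t < n \<and> d t > 0} \<union> {t. t < n \<and> d t < 0}) \<union> {t. t < n \<and> d t = 0}" by auto
  then have "n = card (({t. t < n \<and> d t > 0} \<union> {t. t < n \<and> d t < 0}) \<union> {t. t < n \<and> d t = 0})"
    by (metis card_lessThan)
  also have "\<dots> = card {t. t < n \<and> d t > 0} + card {t. t < n \<and> d t < 0} + card {t. t < n \<and> d t = 0}"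
    by (subst card_Un_disjoint; force?)+
  finally show ?thesis by simp
qed

text \<open>
  Let \<open>q\<^sub>z\<close> be a null vector and \<open>k\<close> an index at which it does not vanish. The form of the new
  matrix \<open>b\<close> exceeds that of \<open>a\<close> by \<open>(x\<^sub>k)\<^sup>2\<close>. Hence it has at most \<open>p + 1\<close> positive eigenvalues (impose
  \<open>x\<^sub>k = 0\<close> as a further condition) and at most \<open>m\<close> negative ones. Its kernel consists of the null
  vectors \<open>x\<close> of \<open>a\<close> with \<open>x\<^sub>k = 0\<close>: pair \<open>b x = 0\<close> with \<open>q\<^sub>z\<close>. So zero is an eigenvalue of smaller
  multiplicity, and as the three numbers add up to \<open>n\<close>, both bounds are attained.
\<close>

lemma inertia_add_diagonal:
  assumes sym: "symmetric_on n a" and "inertia n a p m" "p + m < n"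
  shows "\<exists>k<n. inertia n (\<lambda>i j. a i j + (if i = k \<and> j = k then 1 else 0)) (Suc p) m"
proof -
  obtain q d where qd: "eigenbasis n a q d"
    and p: "card {t. t < n \<and> d t > 0} = p" and m: "card {t. t < n \<and> d t < 0} = m"
    using assms(2) by (auto simp: inertia_def)
  have q: "orthonormal n q n" and eig: "\<And>t i. t < n \<Longrightarrow> i < n \<Longrightarrow> act n a (q t) i = d t * q t i"
    using qd by (auto simp: eigenbasis_def)
  have "card {t. t < n \<and> d t = 0} > 0"
    using card_signs[of n d] p m \<open>p + m < n\<close> by linarith
  then obtain z where z: "z < n" "d z = 0" by (auto simp: card_gt_0_iff)
  have "dot n (q z) (q z) \<noteq> 0" using orthonormalD[OF q z(1) z(1)] by simp
  then obtain k where k: "k < n" "q z k \<noteq> 0" by (auto simp: dot_self_eq_0_iff)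
  define e where "e = (\<lambda>i. if i = k then 1 else 0 :: real)"
  define b where "b = (\<lambda>i j. a i j + (if i = k \<and> j = k then 1 else 0))"
  have e: "dot n e x = x k" for x
    using k(1) sum.delta[of "{..<n}" k x] by (simp add: dot_def e_def if_distrib[of "\<lambda>c. c * _"] cong: if_cong)
  have act: "act n b x i = act n a x i + e i * x k" for x i
  proof -
    have "act n b x i = (\<Sum>j<n. a i j * x j + e i * (e j * x j))"
      unfolding act_def b_def e_def by (intro sum.cong) (auto simp: algebra_simps)
    then show ?thesis using e[of x] by (simp add: act_def sum.distrib dot_def flip: sum_distrib_left)
  qed
  have form: "dot n x (act n b x) = dot n x (act n a x) + (x k)\<^sup>2" for x
  proof -
    have "dot n x (act n b x) = dot n x (act n a x) + dot n e x * x k"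
      unfolding act by (simp add: dot_def algebra_simps sum.distrib sum_distrib_left)
    then show ?thesis by (simp add: e power2_eq_square)
  qed
  have "symmetric_on n b" using sym by (auto simp: b_def symmetric_on_def)
  then obtain q' d' where qd': "eigenbasis n b q' d'" using eigenbasis_exists by blast
  have pos: "card {t. t < n \<and> d' t > 0} \<le> Suc p"
  proof -
    \<comment> \<open>The index \<open>n\<close>, which labels no eigenvector, stands for the condition \<open>x k = 0\<close>.\<close>
    let ?J = "insert n {t. t < n \<and> d t > 0}"
    have "card {t. t < n \<and> d' t > 0} \<le> card ?J"
    proof (rule positive_eigenvalues_le[OF qd', where l = "q(n := e)"])
      fix x assume 0: "\<And>j. j \<in> ?J \<Longrightarrow> dot n ((q(n := e)) j) x = 0"
      then have "x k = 0" using e[of x] 0[of n] by simp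
      moreover have "(\<Sum>t<n. d t * (dot n x (q t))\<^sup>2) \<le> 0"
      proof (rule sum_nonpos)
        fix t assume "t \<in> {..<n}"
        then show "d t * (dot n x (q t))\<^sup>2 \<le> 0"
          using 0[of t] by (cases "d t > 0") (auto simp: dot_commute mult_le_0_iff not_less)
      qed
      ultimately show "dot n x (act n b x) \<le> 0"
        unfolding form form_eigenbasis[OF qd] by simp
    qed simp
    then show ?thesis using p by simp
  qed
  have neg: "card {t. t < n \<and> d' t < 0} \<le> m"
    unfolding m[symmetric]
  proof (rule negative_eigenvalues_le[OF qd', where l = q])
    fix x assume 0: "\<And>j. j \<in> {t. t < n \<and> d t < 0} \<Longrightarrow> dot n (q j) x = 0"
    have "(\<Sum>t<n. d t * (dot n x (q t))\<^sup>2) \<ge> 0"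
    proof (rule sum_nonneg)
      fix t assume "t \<in> {..<n}"
      then show "d t * (dot n x (q t))\<^sup>2 \<ge> 0"
        using 0[of t] by (cases "d t < 0") (auto simp: dot_commute)
    qed
    then show "0 \<le> dot n x (act n b x)"
      unfolding form form_eigenbasis[OF qd] by simp
  qed simp
  have zero: "card {t. t < n \<and> d' t = 0} < card {t. t < n \<and> d t = 0}"
  proof -
    let ?J = "{t. t < n \<and> d t = 0} - {z}"
    have "card {t. t < n \<and> d' t = 0} \<le> card ?J"
    proof (rule zero_eigenvalues_le[OF qd', where l = q])
      fix x i assume ker: "\<And>i. i < n \<Longrightarrow> act n b x i = 0"
        and 0: "\<And>j. j \<in> ?J \<Longrightarrow> dot n (q j) x = 0" and "i < n"
      have "dot n (q z) (act n b x) = 0" using ker by (simp add: dot_def)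
      moreover have "dot n (q z) (act n b x) = dot n (q z) (act n a x) + dot n e (q z) * x k"
        unfolding act by (simp add: dot_def algebra_simps sum.distrib sum_distrib_left)
      moreover have "dot n (q z) (act n a x) = 0"
        using eig[OF z(1)] z by (simp add: act_symmetric[OF sym]) (simp add: dot_def)
      ultimately have xk: "x k = 0" using k by (simp add: e)
      then have kera: "act n a x i = 0" if "i < n" for i using ker[OF that] act by simp
      have perp: "dot n x (q t) = 0" if "t < n" "t \<noteq> z" for t
      proof (cases "d t = 0")
        case True
        then show ?thesis using 0[of t] that by (simp add: dot_commute)
      next
        case False
        have "0 = dot n (q t) (act n a x)" using kera by (simp add: dot_def)
        also have "\<dots> = dot n (\<lambda>i. d t * q t i) x"
          unfolding act_symmetric[OF sym] using eig[OF that(1)] by (intro dot_cong) auto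
        also have "\<dots> = d t * dot n x (q t)" by (simp add: dot_scale_left dot_commute)
        finally show ?thesis using False by simp
      qed
      have xz: "x i = dot n x (q z) * q z i" if "i < n" for i
      proof -
        have "x i = (\<Sum>t<n. if t = z then dot n x (q z) * q z i else 0)"
          unfolding orthonormal_expansion[OF q that, of x] using perp by (intro sum.cong) auto
        then show ?thesis using z by simp
      qed
      from xz[OF k(1)] xk k have "dot n x (q z) = 0" by simp
      with xz[OF \<open>i < n\<close>] show "x i = 0" by simp
    qed simp
    also have "\<dots> < card {t. t < n \<and> d t = 0}" by (rule psubset_card_mono) (use z in auto)
    finally show ?thesis .
  qed
  have "card {t. t < n \<and> d' t > 0} = Suc p" "card {t. t < n \<and> d' t < 0} = m"
    using pos neg zero card_signs[of n d] card_signs[of n d'] p m by linarith+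
  with qd' have "inertia n b (Suc p) m" by (auto simp: inertia_def)
  with k show ?thesis unfolding b_def by blast
qed

definition same_off_diagonal :: "nat \<Rightarrow> (nat \<Rightarrow> nat \<Rightarrow> real) \<Rightarrow> (nat \<Rightarrow> nat \<Rightarrow> real) \<Rightarrow> bool" where
  "same_off_diagonal n a b \<longleftrightarrow> (\<forall>i<n. \<forall>j<n. i \<noteq> j \<longrightarrow> b i j = a i j)"

lemma same_off_diagonal_symmetric:
  assumes "symmetric_on n a" "same_off_diagonal n a b"
  shows "symmetric_on n b"
  unfolding symmetric_on_def
proof (intro allI impI)
  fix i j assume "i < n" "j < n"
  then show "b i j = b j i"
    using assms by (cases "i = j") (auto simp: symmetric_on_def same_off_diagonal_def)
qed

lemma inertia_increase_diagonal:
  assumes sym: "symmetric_on n a" and "inertia n a p m"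
    and "p \<le> r" "m \<le> s" "r + s \<le> n"
  shows "\<exists>b. same_off_diagonal n a b \<and> inertia n b r s"
  using assms
proof (induction "r + s - p - m" arbitrary: a p m rule: less_induct)
  case less
  consider "p < r" | "m < s" | "p = r" "m = s" using less.prems by linarith
  then show ?case
  proof cases
    case 1
    then obtain k where k: "inertia n (\<lambda>i j. a i j + (if i = k \<and> j = k then 1 else 0)) (Suc p) m"
      (is "inertia n ?b _ _") using inertia_add_diagonal[OF less.prems(1,2)] less.prems by auto
    have off: "same_off_diagonal n a ?b" by (auto simp: same_off_diagonal_def)
    have "\<exists>c. same_off_diagonal n ?b c \<and> inertia n c r s"
      by (rule less.hyps[OF _ same_off_diagonal_symmetric[OF less.prems(1) off] k])
        (use 1 less.prems in auto)
    with off show ?thesis by (auto simp: same_off_diagonal_def)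
  next
    case 2
    have "symmetric_on n (\<lambda>i j. - a i j)" using less.prems by (simp add: symmetric_on_def)
    then obtain k where "inertia n (\<lambda>i j. - a i j + (if i = k \<and> j = k then 1 else 0)) (Suc m) p"
      using inertia_add_diagonal[OF _ inertia_uminus[OF less.prems(2)]] less.prems 2 by auto
    from inertia_uminus[OF this]
    have k: "inertia n (\<lambda>i j. a i j - (if i = k \<and> j = k then 1 else 0)) p (Suc m)"
      (is "inertia n ?b _ _") by simp
    have off: "same_off_diagonal n a ?b" by (auto simp: same_off_diagonal_def)
    have "\<exists>c. same_off_diagonal n ?b c \<and> inertia n c r s"
      by (rule less.hyps[OF _ same_off_diagonal_symmetric[OF less.prems(1) off] k])
        (use 2 less.prems in auto)
    with off show ?thesis by (auto simp: same_off_diagonal_def)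
  next
    case 3
    then show ?thesis using less.prems by (intro exI[of _ a]) (auto simp: same_off_diagonal_def)
  qed
qed

section \<open>The weighted Laplacian of a spanning forest\<close>

lemma laplacian_form:
  assumes w: "symmetric_on n w"
  shows "dot n x (act n (\<lambda>i j. (if i = j then \<Sum>k<n. w i k else 0) - w i j) x)
    = (\<Sum>i<n. \<Sum>j<n. w i j * (x i - x j)\<^sup>2) / 2"
proof -
  have "act n (\<lambda>i j. (if i = j then \<Sum>k<n. w i k else 0) - w i j) x i
    = (\<Sum>j<n. w i j * x i - w i j * x j)" if "i < n" for i
  proof -
    have "act n (\<lambda>i j. (if i = j then \<Sum>k<n. w i k else 0) - w i j) x i
      = (\<Sum>j<n. (if i = j then (\<Sum>k<n. w i k) * x i else 0) - w i j * x j)"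
      unfolding act_def by (intro sum.cong) (auto simp: algebra_simps)
    then show ?thesis using that by (simp add: sum_subtractf sum_distrib_right)
  qed
  then have lhs: "dot n x (act n (\<lambda>i j. (if i = j then \<Sum>k<n. w i k else 0) - w i j) x)
    = (\<Sum>i<n. \<Sum>j<n. x i * (w i j * x i - w i j * x j))" (is "_ = ?S")
    by (simp add: dot_def sum_distrib_left)
  have "?S = (\<Sum>j<n. \<Sum>i<n. x i * (w i j * x i - w i j * x j))" by (rule sum.swap)
  also have "\<dots> = (\<Sum>i<n. \<Sum>j<n. x j * (w i j * x j - w i j * x i))"
    using w by (intro sum.cong refl) (auto simp: symmetric_on_def)
  finally have "2 * ?S = (\<Sum>i<n. \<Sum>j<n. x i * (w i j * x i - w i j * x j))
    + (\<Sum>i<n. \<Sum>j<n. x j * (w i j * x j - w i j * x i))" by simp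
  also have "\<dots> = (\<Sum>i<n. \<Sum>j<n. w i j * (x i - x j)\<^sup>2)"
    unfolding sum.distrib[symmetric]
    by (intro sum.cong refl) (simp add: algebra_simps power2_eq_square)
  finally show ?thesis using lhs by simp
qed

text \<open>
  Each vertex of \<open>W\<close> other than the root of its component has a neighbour in \<open>W\<close> as its parent. The
  decreasing \<open>height\<close> guarantees that following parents ends, and it does so in \<open>root v\<close>, since
  adjacent vertices have the same root.
\<close>

locale rooted_spanning_forest =
  fixes W :: "nat set" and E :: "(nat \<times> nat) set"
    and root parent height :: "nat \<Rightarrow> nat"
  assumes sym_E: "sym E" and irrefl_E: "irrefl E" and fin_W: "finite W"
    and parent_W: "v \<in> W \<Longrightarrow> v \<noteq> root v \<Longrightarrow> parent v \<in> W"
    and parent_E: "v \<in> W \<Longrightarrow> v \<noteq> root v \<Longrightarrow> (v, parent v) \<in> E"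
    and parent_height: "v \<in> W \<Longrightarrow> v \<noteq> root v \<Longrightarrow> height (parent v) < height v"
    and root_E: "v \<in> W \<Longrightarrow> w \<in> W \<Longrightarrow> (v, w) \<in> E \<Longrightarrow> root v = root w"
begin

definition nonroots :: "nat set" where
  "nonroots = {v \<in> W. v \<noteq> root v}"

text \<open>
  Each forest edge is counted at its lower end, so that \<open>\<kappa>\<close> can be given as a function of the vertices
  that are not roots; the transposed term in \<open>edge_weight\<close> restores symmetry.
\<close>

definition tree_weight :: "(nat \<Rightarrow> real) \<Rightarrow> nat \<Rightarrow> nat \<Rightarrow> real" where
  "tree_weight \<kappa> i j = (if i \<in> nonroots \<and> parent i = j then \<kappa> i else 0)"

definition edge_weight :: "(nat \<Rightarrow> real) \<Rightarrow> nat \<Rightarrow> nat \<Rightarrow> real" where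
  "edge_weight \<kappa> i j =
     (if i \<in> W \<and> j \<in> W \<and> (i, j) \<in> E then 1 else 0) + tree_weight \<kappa> i j + tree_weight \<kappa> j i"

text \<open>
  The Laplacian of the edge weights on \<open>W\<close>, plus the adjacency matrix of the edges that are not inside
  \<open>W\<close>.
\<close>

definition forest_matrix :: "nat \<Rightarrow> (nat \<Rightarrow> real) \<Rightarrow> nat \<Rightarrow> nat \<Rightarrow> real" where
  "forest_matrix n \<kappa> i j =
     ((if i = j then \<Sum>k<n. edge_weight \<kappa> i k else 0) - edge_weight \<kappa> i j)
     + (if (i, j) \<in> E \<and> \<not> (i \<in> W \<and> j \<in> W) then 1 else 0)"

lemma finite_nonroots: "finite nonroots"
  using fin_W by (simp add: nonroots_def)

lemma edge_weight_commute: "edge_weight \<kappa> i j = edge_weight \<kappa> j i"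
  using sym_E by (auto simp: edge_weight_def dest: symD)

lemma symmetric_forest_matrix: "symmetric_on n (forest_matrix n \<kappa>)"
  using sym_E by (auto simp: symmetric_on_def forest_matrix_def edge_weight_commute dest: symD)

text \<open>
  A forest edge carries the weight \<open>1 + \<kappa> v\<close> for its lower end \<open>v\<close> only, since the height decreases
  towards the parent; \<open>\<bar>\<kappa> v\<bar> > 1\<close> prevents cancellation.
\<close>

lemma forest_matrix_pattern:
  assumes \<kappa>: "\<And>v. \<bar>\<kappa> v\<bar> > 1" and "i \<noteq> j"
  shows "forest_matrix n \<kappa> i j \<noteq> 0 \<longleftrightarrow> (i, j) \<in> E"
proof (cases "i \<in> W \<and> j \<in> W \<and> (i, j) \<in> E")
  case True
  have "\<not> (tree_weight \<kappa> i j \<noteq> 0 \<and> tree_weight \<kappa> j i \<noteq> 0)"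
    using parent_height[of i] parent_height[of j] by (auto simp: tree_weight_def nonroots_def)
  moreover have "1 + tree_weight \<kappa> i j \<noteq> 0" "1 + tree_weight \<kappa> j i \<noteq> 0"
    using \<kappa>[of i] \<kappa>[of j] by (auto simp: tree_weight_def)
  ultimately have "edge_weight \<kappa> i j \<noteq> 0" using True by (auto simp: edge_weight_def)
  then show ?thesis using True \<open>i \<noteq> j\<close> by (simp add: forest_matrix_def)
next
  case False
  have "tree_weight \<kappa> i j = 0" "tree_weight \<kappa> j i = 0"
    using False parent_W[of i] parent_W[of j] parent_E[of i] parent_E[of j] sym_E
    by (auto simp: tree_weight_def nonroots_def dest: symD)
  then have "edge_weight \<kappa> i j = 0" using False by (simp add: edge_weight_def)
  then show ?thesis using False \<open>i \<noteq> j\<close> by (auto simp: forest_matrix_def)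
qed

definition inner_edges_form :: "nat \<Rightarrow> (nat \<Rightarrow> real) \<Rightarrow> real" where
  "inner_edges_form n x =
     (\<Sum>i<n. \<Sum>j<n. if i \<in> W \<and> j \<in> W \<and> (i, j) \<in> E then (x i - x j)\<^sup>2 else 0) / 2"

lemma forest_matrix_form:
  assumes W: "W \<subseteq> {..<n}" and x: "\<And>i. i < n \<Longrightarrow> i \<notin> W \<Longrightarrow> x i = 0"
  shows "dot n x (act n (forest_matrix n \<kappa>) x)
    = inner_edges_form n x + (\<Sum>v\<in>nonroots. \<kappa> v * (x v - x (parent v))\<^sup>2)"
proof -
  let ?L = "\<lambda>i j. (if i = j then \<Sum>k<n. edge_weight \<kappa> i k else 0) - edge_weight \<kappa> i j"
  let ?e = "\<lambda>i j. if i \<in> W \<and> j \<in> W \<and> (i, j) \<in> E then 1 else 0 :: real"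
  have "dot n x (act n (forest_matrix n \<kappa>) x) = dot n x (act n ?L x)"
  proof -
    have "x i * (forest_matrix n \<kappa> i j * x j) = x i * (?L i j * x j)" if "i < n" "j < n" for i j
      using x[of i] x[of j] that unfolding forest_matrix_def by auto
    then show ?thesis
      unfolding dot_def act_def sum_distrib_left by (intro sum.cong refl) auto
  qed
  also have "\<dots> = (\<Sum>i<n. \<Sum>j<n. edge_weight \<kappa> i j * (x i - x j)\<^sup>2) / 2"
    by (rule laplacian_form) (simp add: symmetric_on_def edge_weight_commute)
  also have "(\<Sum>i<n. \<Sum>j<n. edge_weight \<kappa> i j * (x i - x j)\<^sup>2)
    = (\<Sum>i<n. \<Sum>j<n. ?e i j * (x i - x j)\<^sup>2)
      + (\<Sum>i<n. \<Sum>j<n. tree_weight \<kappa> i j * (x i - x j)\<^sup>2)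
      + (\<Sum>i<n. \<Sum>j<n. tree_weight \<kappa> j i * (x i - x j)\<^sup>2)"
    unfolding sum.distrib[symmetric] by (intro sum.cong refl) (simp add: edge_weight_def algebra_simps)
  also have "(\<Sum>i<n. \<Sum>j<n. tree_weight \<kappa> j i * (x i - x j)\<^sup>2)
    = (\<Sum>j<n. \<Sum>i<n. tree_weight \<kappa> j i * (x i - x j)\<^sup>2)" by (rule sum.swap)
  also have "\<dots> = (\<Sum>i<n. \<Sum>j<n. tree_weight \<kappa> i j * (x i - x j)\<^sup>2)"
    by (simp add: power2_commute)
  also have "\<dots> = (\<Sum>v\<in>nonroots. \<kappa> v * (x v - x (parent v))\<^sup>2)"
  proof -
    have "(\<Sum>j<n. tree_weight \<kappa> i j * (x i - x j)\<^sup>2)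
      = (if i \<in> nonroots then \<kappa> i * (x i - x (parent i))\<^sup>2 else 0)" for i
    proof (cases "i \<in> nonroots")
      case True
      then have "parent i < n" using parent_W[of i] W by (auto simp: nonroots_def)
      have "(\<Sum>j<n. tree_weight \<kappa> i j * (x i - x j)\<^sup>2)
        = (\<Sum>j<n. if j = parent i then \<kappa> i * (x i - x (parent i))\<^sup>2 else 0)"
        using True by (intro sum.cong) (auto simp: tree_weight_def)
      then show ?thesis using True \<open>parent i < n\<close> by simp
    qed (simp add: tree_weight_def)
    moreover have "nonroots \<subseteq> {..<n}" using W by (auto simp: nonroots_def)
    then have "{..<n} \<inter> nonroots = nonroots" by auto
    ultimately show ?thesis by (simp add: sum.If_cases Collect_mem_eq)
  qed
  also have "(\<Sum>i<n. \<Sum>j<n. ?e i j * (x i - x j)\<^sup>2) = 2 * inner_edges_form n x"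
    unfolding inner_edges_form_def by (simp add: if_distrib[of "\<lambda>c. c * _"] cong: if_cong)
  finally show ?thesis by simp
qed

lemma inner_edges_form_nonneg: "inner_edges_form n x \<ge> 0"
  unfolding inner_edges_form_def by (auto intro!: sum_nonneg divide_nonneg_nonneg)

lemma root_distance:
  assumes D: "\<And>v. v \<in> nonroots \<Longrightarrow> \<bar>x v - x (parent v)\<bar> \<le> (D :: real)" and "D \<ge> 0" "v \<in> W"
  shows "\<bar>x v - x (root v)\<bar> \<le> real (height v) * D"
  using \<open>v \<in> W\<close>
proof (induction "height v" arbitrary: v rule: less_induct)
  case less
  show ?case
  proof (cases "v = root v")
    case False
    have pv: "parent v \<in> W" "height (parent v) < height v" "root (parent v) = root v"
      using False less.prems parent_W parent_height parent_E root_E by metis+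
    have "\<bar>x v - x (root v)\<bar> \<le> \<bar>x v - x (parent v)\<bar> + \<bar>x (parent v) - x (root (parent v))\<bar>"
      unfolding pv(3) by linarith
    also have "\<dots> \<le> D + real (height (parent v)) * D"
      using D[of v] False less.prems less.hyps[OF pv(2,1)] by (auto simp: nonroots_def)
    also have "\<dots> = (1 + real (height (parent v))) * D" by (simp add: algebra_simps)
    also have "\<dots> \<le> real (height v) * D"
      using pv(2) \<open>D \<ge> 0\<close> by (intro mult_right_mono) auto
    finally show ?thesis .
  qed (use \<open>D \<ge> 0\<close> in simp)
qed

text \<open>
  The sum of all heights is a crude bound for the distance of any vertex from its root. With this
  constant, the at most \<open>n\<^sup>2\<close> squares in \<open>inner_edges_form\<close> are dominated by the forest edges. The
  summand \<open>2\<close> keeps it larger than \<open>1\<close>, as \<open>forest_matrix_pattern\<close> needs.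
\<close>

definition dominating_weight :: "nat \<Rightarrow> real" where
  "dominating_weight n = 2 + 2 * (real n * real (\<Sum>v\<in>W. height v))\<^sup>2"

text \<open>
  With \<open>S\<close> the sum on the right, no forest edge has a difference larger than \<open>sqrt S\<close>: it is zero off
  \<open>M\<close>. Adjacent vertices have the same root, so the difference along any edge is at most twice the
  sum of all heights times \<open>sqrt S\<close>.
\<close>

lemma inner_edges_form_le:
  assumes M: "M \<subseteq> nonroots" and 0: "\<And>v. v \<in> nonroots - M \<Longrightarrow> x v = x (parent v)"
  shows "inner_edges_form n x \<le> dominating_weight n * (\<Sum>v\<in>M. (x v - x (parent v))\<^sup>2)"
proof -
  define S where "S = (\<Sum>v\<in>M. (x v - x (parent v))\<^sup>2)"
  define H where "H = real (\<Sum>v\<in>W. height v)"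
  have finM: "finite M" using M finite_nonroots finite_subset by blast
  have S: "S \<ge> 0" unfolding S_def by (rule sum_nonneg) simp
  have D: "\<bar>x v - x (parent v)\<bar> \<le> sqrt S" if "v \<in> nonroots" for v
  proof (cases "v \<in> M")
    case True
    have "(x v - x (parent v))\<^sup>2 \<le> S"
      unfolding S_def by (rule member_le_sum[OF True _ finM]) simp
    then show ?thesis by (simp add: real_le_rsqrt)
  qed (use 0[of v] that S in simp)
  have dist: "\<bar>x v - x (root v)\<bar> \<le> H * sqrt S" if "v \<in> W" for v
  proof -
    have "height v \<le> (\<Sum>v\<in>W. height v)" by (rule member_le_sum[OF that _ fin_W]) simp
    then have "real (height v) * sqrt S \<le> H * sqrt S"
      unfolding H_def using S by (intro mult_right_mono) (auto simp del: of_nat_sum)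
    then show ?thesis using root_distance[of x "sqrt S" v] D S that by auto
  qed
  have edge: "(x i - x j)\<^sup>2 \<le> 4 * H\<^sup>2 * S" if "i \<in> W" "j \<in> W" "(i, j) \<in> E" for i j
  proof -
    have "\<bar>x i - x j\<bar> \<le> 2 * H * sqrt S"
      using dist[OF that(1)] dist[OF that(2)] root_E[OF that] by (simp add: abs_le_iff)
    then have "(x i - x j)\<^sup>2 \<le> (2 * H * sqrt S)\<^sup>2" by (metis abs_ge_zero power2_abs power_mono)
    also have "\<dots> = 4 * H\<^sup>2 * S" using S by (simp add: power_mult_distrib)
    finally show ?thesis .
  qed
  have "(\<Sum>i<n. \<Sum>j<n. if i \<in> W \<and> j \<in> W \<and> (i, j) \<in> E then (x i - x j)\<^sup>2 else 0)
    \<le> (\<Sum>i<n. \<Sum>j<n. 4 * H\<^sup>2 * S)"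
    using edge S by (intro sum_mono) auto
  then have "inner_edges_form n x \<le> 2 * (real n * H)\<^sup>2 * S"
    unfolding inner_edges_form_def by (simp add: power2_eq_square algebra_simps)
  also have "\<dots> \<le> dominating_weight n * S"
    unfolding dominating_weight_def H_def using S by (intro mult_right_mono) auto
  finally show ?thesis by (simp add: S_def)
qed

text \<open>
  The form is nonpositive once \<open>x\<close> vanishes outside \<open>W\<close> and the differences along the forest edges
  below \<open>P\<close> vanish, by \<open>inner_edges_form_le\<close>; it is nonnegative once \<open>x\<close> vanishes outside \<open>W\<close> and the
  differences along the other forest edges vanish. The functional \<open>l\<close> encodes these conditions.
\<close>

lemma forest_matrix_inertia:
  assumes W: "W \<subseteq> {..<n}" and P: "P \<subseteq> nonroots"
    and \<kappa>: "\<And>v. \<kappa> v = (if v \<in> P then dominating_weight n else - dominating_weight n)"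
  shows "\<exists>p m. inertia n (forest_matrix n \<kappa>) p m \<and>
    p \<le> n - card W + card P \<and> m \<le> n - card W + card (nonroots - P)"
proof -
  obtain q d where qd: "eigenbasis n (forest_matrix n \<kappa>) q d"
    using eigenbasis_exists[OF symmetric_forest_matrix] by blast
  define l where "l j i = (if i = j then 1 else 0) - (if j \<in> W \<and> i = parent j then 1 else 0 :: real)" for j i
  have nonW: "nonroots \<subseteq> W" by (auto simp: nonroots_def)
  have l_W: "dot n (l j) x = x j - x (parent j)" if "j \<in> nonroots" for j x
  proof -
    have "j < n" "parent j < n" "j \<in> W" using that W parent_W by (auto simp: nonroots_def)
    then show ?thesis
      by (simp add: dot_def l_def left_diff_distrib sum_subtractf if_distrib[of "\<lambda>c. c * _"] cong: if_cong)
  qed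
  have l_U: "dot n (l j) x = x j" if "j < n" "j \<notin> W" for j x
    using that by (simp add: dot_def l_def if_distrib[of "\<lambda>c. c * _"] cong: if_cong)
  have form: "dot n x (act n (forest_matrix n \<kappa>) x) = inner_edges_form n x
      + dominating_weight n * (\<Sum>v\<in>P. (x v - x (parent v))\<^sup>2)
      - dominating_weight n * (\<Sum>v\<in>nonroots - P. (x v - x (parent v))\<^sup>2)"
    if "\<And>i. i < n \<Longrightarrow> i \<notin> W \<Longrightarrow> x i = 0" for x
  proof -
    have "(\<Sum>v\<in>nonroots. \<kappa> v * (x v - x (parent v))\<^sup>2)
      = (\<Sum>v\<in>nonroots - P. \<kappa> v * (x v - x (parent v))\<^sup>2) + (\<Sum>v\<in>P. \<kappa> v * (x v - x (parent v))\<^sup>2)"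
      by (rule sum.subset_diff[OF P finite_nonroots])
    also have "(\<Sum>v\<in>P. \<kappa> v * (x v - x (parent v))\<^sup>2)
      = dominating_weight n * (\<Sum>v\<in>P. (x v - x (parent v))\<^sup>2)"
      by (simp add: \<kappa> sum_distrib_left)
    also have "(\<Sum>v\<in>nonroots - P. \<kappa> v * (x v - x (parent v))\<^sup>2)
      = - dominating_weight n * (\<Sum>v\<in>nonroots - P. (x v - x (parent v))\<^sup>2)"
      by (simp add: \<kappa> sum_distrib_left)
    finally show ?thesis using forest_matrix_form[OF W, of x \<kappa>] that by simp
  qed
  have card: "finite (({..<n} - W) \<union> M)" "card (({..<n} - W) \<union> M) = n - card W + card M"
    if "M \<subseteq> nonroots" for M
  proof -
    have "finite M" using that finite_nonroots finite_subset by blast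
    then show "finite (({..<n} - W) \<union> M)" by simp
    have "card (({..<n} - W) \<union> M) = card ({..<n} - W) + card M"
      using that nonW \<open>finite M\<close> by (intro card_Un_disjoint) auto
    then show "card (({..<n} - W) \<union> M) = n - card W + card M"
      using W fin_W by (simp add: card_Diff_subset)
  qed
  have "card {t. t < n \<and> d t > 0} \<le> card (({..<n} - W) \<union> P)"
  proof (rule positive_eigenvalues_le[OF qd card(1)[OF P], where l = l])
    fix x assume 0: "\<And>j. j \<in> ({..<n} - W) \<union> P \<Longrightarrow> dot n (l j) x = 0"
    have U: "x i = 0" if "i < n" "i \<notin> W" for i using 0[of i] l_U that by simp
    have V: "x v = x (parent v)" if "v \<in> P" for v using 0[of v] l_W[of v x] that P by auto
    have "inner_edges_form n x
      \<le> dominating_weight n * (\<Sum>v\<in>nonroots - P. (x v - x (parent v))\<^sup>2)"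
      by (rule inner_edges_form_le) (use V in auto)
    moreover have "(\<Sum>v\<in>P. (x v - x (parent v))\<^sup>2) = 0" using V by simp
    ultimately show "dot n x (act n (forest_matrix n \<kappa>) x) \<le> 0" using form[OF U] by simp
  qed
  moreover have "card {t. t < n \<and> d t < 0} \<le> card (({..<n} - W) \<union> (nonroots - P))"
  proof (rule negative_eigenvalues_le[OF qd card(1), where l = l])
    fix x assume 0: "\<And>j. j \<in> ({..<n} - W) \<union> (nonroots - P) \<Longrightarrow> dot n (l j) x = 0"
    have U: "x i = 0" if "i < n" "i \<notin> W" for i using 0[of i] l_U that by simp
    have V: "x v = x (parent v)" if "v \<in> nonroots - P" for v using 0[of v] l_W[of v x] that by auto
    have "(\<Sum>v\<in>nonroots - P. (x v - x (parent v))\<^sup>2) = 0" using V by simp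
    moreover have "0 \<le> (\<Sum>v\<in>P. (x v - x (parent v))\<^sup>2)" by (rule sum_nonneg) simp
    ultimately show "dot n x (act n (forest_matrix n \<kappa>) x) \<ge> 0"
      using form[OF U] inner_edges_form_nonneg[of n x] by (simp add: dominating_weight_def)
  qed auto
  ultimately show ?thesis
    using qd card(2)[OF P] card(2)[of "nonroots - P"] by (auto simp: inertia_def)
qed

end

section \<open>Components and spanning forests of graphs\<close>

text \<open>
  A breadth-first forest: the root is a chosen representative of the component, the height is the
  distance from it, and the parent is the last but one vertex of a shortest path. As the chosen
  representative depends only on the set of vertices that reach \<open>v\<close>, adjacent vertices share it.
\<close>

lemma rooted_spanning_forest_exists:
  assumes E: "sym E" "irrefl E" and W: "finite W"
  shows "\<exists>root parent height. rooted_spanning_forest W E root parent height \<and>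
    (\<forall>v\<in>W. root v \<in> W \<and> (root v, v) \<in> (E \<inter> W \<times> W)\<^sup>*)"
proof -
  define R where "R = E \<inter> W \<times> W"
  have symR: "sym R" using E(1) by (auto simp: R_def sym_def)
  define root where "root v = (SOME w. (w, v) \<in> R\<^sup>*)" for v
  define height where "height v = (LEAST m. (root v, v) \<in> R ^^ m)" for v
  have root: "(root v, v) \<in> R\<^sup>*" for v unfolding root_def by (rule someI[of _ v]) simp
  have root_R: "root v = root w" if "(v, w) \<in> R" for v w
  proof -
    have "(w, v) \<in> R" using symR that by (rule symD)
    with that have "(\<lambda>x. (x, v) \<in> R\<^sup>*) = (\<lambda>x. (x, w) \<in> R\<^sup>*)"
      by (auto intro: rtrancl_into_rtrancl)
    then show ?thesis unfolding root_def by simp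
  qed
  have height: "(root v, v) \<in> R ^^ height v" for v
    unfolding height_def by (rule LeastI_ex) (rule rtrancl_imp_relpow[OF root])
  have "\<exists>u. (u, v) \<in> R \<and> height u < height v" if "v \<noteq> root v" for v
  proof (cases "height v")
    case 0
    then show ?thesis using height[of v] that by simp
  next
    case (Suc m)
    then obtain u where u: "(root v, u) \<in> R ^^ m" "(u, v) \<in> R" using height[of v] by auto
    then have "height u \<le> m" unfolding height_def[of u] root_R[OF u(2)] by (intro Least_le)
    then show ?thesis using u Suc by auto
  qed
  then obtain parent where par: "\<And>v. v \<noteq> root v \<Longrightarrow> (parent v, v) \<in> R \<and> height (parent v) < height v"
    by metis
  have "rooted_spanning_forest W E root parent height"
  proof
    show "sym E" "irrefl E" "finite W" by fact+
  next
    fix v assume "v \<in> W" "v \<noteq> root v"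
    then show "parent v \<in> W" "(v, parent v) \<in> E" "height (parent v) < height v"
      using par[of v] E(1) by (auto simp: R_def dest: symD)
  next
    fix v w assume "v \<in> W" "w \<in> W" "(v, w) \<in> E"
    then show "root v = root w" by (intro root_R) (simp add: R_def)
  qed
  moreover have "root v \<in> W" if "v \<in> W" for v
    using root[of v] that by (cases rule: converse_rtranclE) (auto simp: R_def)
  ultimately show ?thesis using root unfolding R_def by blast
qed

lemma induced_subgraph_with_projD:
  assumes "induced_subgraph F (with_proj G)"
  shows "wf_digraph F" "verts F \<subseteq> pverts G" "tail F = fst" "head F = snd"
    "arcs F = parcs G \<inter> verts F \<times> verts F"
  using assms by (auto simp: induced_subgraph_def subgraph_def compatible_def)

text \<open>
  The maximum in \<open>max_disconnection\<close> is one over a finite nonempty set because an induced subgraph is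
  determined by its vertices.
\<close>

lemma max_disconnection_attained:
  assumes G: "pair_graph G" and k: "k \<le> card (pverts G)"
  shows "\<exists>F. induced_subgraph F (with_proj G) \<and> card (verts F) = card (pverts G) - k \<and>
    max_disconnection k G = num_components F"
proof -
  interpret pair_graph G by fact
  let ?Fs = "{F. induced_subgraph F (with_proj G) \<and> card (verts F) = card (pverts G) - k}"
  let ?sub = "\<lambda>V. \<lparr>verts = V, arcs = parcs G \<inter> V \<times> V, tail = fst, head = snd\<rparr>"
  have "F = ?sub (verts F)" if "F \<in> ?Fs" for F
    using induced_subgraph_with_projD[of F G] that by (cases F) auto
  moreover have "verts F \<subseteq> pverts G" if "F \<in> ?Fs" for F
    using induced_subgraph_with_projD[of F G] that by auto
  ultimately have "?Fs \<subseteq> ?sub ` Pow (pverts G)" by blast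
  then have "finite ?Fs" by (rule finite_subset) simp
  moreover obtain V where V: "V \<subseteq> pverts G" "card V = card (pverts G) - k"
    using obtain_subset_with_card_n[of "card (pverts G) - k" "pverts G"] by auto
  have "induced_subgraph (with_proj G \<restriction> V) (with_proj G)" using V(1) by (intro induced_induce) simp
  then have "with_proj G \<restriction> V \<in> ?Fs" using V by simp
  ultimately have "max_disconnection k G \<in> num_components ` ?Fs"
    unfolding max_disconnection_def setcompr_eq_image by (intro Max_in) auto
  then show ?thesis by auto
qed

lemma num_components_le_roots:
  fixes F :: "('a, 'b) pre_digraph" and root :: "'a \<Rightarrow> 'a"
  assumes F: "wf_digraph F" "finite (verts F)" and sym: "sym (arcs_ends F)"
    and root: "\<And>v. v \<in> verts F \<Longrightarrow> root v \<in> verts F \<and> (root v, v) \<in> (arcs_ends F)\<^sup>*"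
  shows "num_components F \<le> card (root ` verts F)"
proof -
  interpret wf_digraph F by fact
  have reach: "u \<rightarrow>\<^sup>*\<^bsub>F\<^esub> v" if "(u, v) \<in> (arcs_ends F)\<^sup>*" "u \<in> verts F" for u v
    using that by (induction rule: rtrancl_induct) (auto intro: reachable_adj_trans)
  have "scc_of v = scc_of (root v)" if "v \<in> verts F" for v
  proof -
    have "root v \<rightarrow>\<^sup>*\<^bsub>F\<^esub> v" "v \<rightarrow>\<^sup>*\<^bsub>F\<^esub> root v"
      using root[OF that] that sym_rtrancl[OF sym] by (auto intro!: reach dest: symD)
    then show ?thesis by (auto simp: scc_of_def intro: reachable_trans)
  qed
  then have "scc_of ` verts F \<subseteq> scc_of ` root ` verts F" by auto
  then have "card (scc_of ` verts F) \<le> card (scc_of ` root ` verts F)"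
    using F(2) by (intro card_mono) auto
  also have "\<dots> \<le> card (root ` verts F)" using F(2) by (intro card_image_le) simp
  finally show ?thesis
    by (simp add: num_components_def card_sccs_verts[symmetric] sccs_verts_conv_scc_of)
qed

theorem lemma1p2:
  fixes n k :: nat and r s :: int and G :: "nat pair_pre_digraph"
  assumes "simple_graph_on n G"
    and "k \<in> {0..n}"
    and "max_disconnection k G \<ge> k"
    and "r \<ge> int k" and "s \<ge> int k"
    and "r + s = int n - int (max_disconnection k G) + int k"
  shows "\<exists>A \<in> sym_matrices G. pin A = (nat r, nat s)"
proof -
  have G: "pair_graph G" and vG: "pverts G = {0..<n}" using assms(1) by (auto simp: simple_graph_on_def)
  interpret pair_graph G by fact
  have symE: "sym (parcs G)" by (rule symI) (rule arcs_symmetric)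
  have irrE: "irrefl (parcs G)" using no_loops' by (auto simp: irrefl_def)
  obtain F where F: "induced_subgraph F (with_proj G)" and cardF: "card (verts F) = n - k"
    and c: "max_disconnection k G = num_components F"
    using max_disconnection_attained[OF G, of k] vG assms(2) by auto
  note F' = induced_subgraph_with_projD[OF F]
  define W where "W = verts F"
  have W: "W \<subseteq> {..<n}" "finite W" "card W = n - k"
    using F'(2) cardF vG finite_subset[of W "{0..<n}"] by (auto simp: W_def)
  obtain root parent height where forest: "rooted_spanning_forest W (parcs G) root parent height"
    and root: "\<And>v. v \<in> W \<Longrightarrow> root v \<in> W \<and> (root v, v) \<in> (parcs G \<inter> W \<times> W)\<^sup>*"
    using rooted_spanning_forest_exists[OF symE irrE W(2)] by auto
  interpret rooted_spanning_forest W "parcs G" root parent height by fact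
  have endsF: "arcs_ends F = parcs G \<inter> W \<times> W"
    using F' by (auto simp: arcs_ends_def arc_to_ends_def W_def)
  have "sym (arcs_ends F)" unfolding endsF using symE by (auto simp: sym_def)
  then have roots: "num_components F \<le> card (root ` W)"
    unfolding W_def using F'(1) W(2) root by (intro num_components_le_roots) (auto simp: endsF W_def)
  have "root ` W = W - nonroots"
  proof -
    have const: "root u = root v" if "(u, v) \<in> (parcs G \<inter> W \<times> W)\<^sup>*" for u v
      using that by (induction rule: rtrancl_induct) (auto dest: root_E)
    have "root (root v) = root v" if "v \<in> W" for v
      using const root[OF that] by blast
    then show ?thesis using root by (force simp: nonroots_def)
  qed
  moreover have "nonroots \<subseteq> W" by (auto simp: nonroots_def)
  ultimately have "card (root ` W) + card nonroots = card W"
    using W(2) finite_nonroots by (simp add: card_Diff_subset card_mono)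
  then have nonroots: "card nonroots + num_components F \<le> n - k" using roots W(3) by simp
  \<comment> \<open>At most \<open>r - k\<close> forest edges get the positive sign; what is left over does not exceed \<open>s - k\<close>.\<close>
  define p where "p = min (nat r - k) (card nonroots)"
  obtain P where P: "P \<subseteq> nonroots" "card P = p"
    using obtain_subset_with_card_n[of p nonroots] by (auto simp: p_def)
  have cardN: "card (nonroots - P) = card nonroots - p"
    using P finite_subset[OF P(1) finite_nonroots] by (simp add: card_Diff_subset)
  define \<kappa> where "\<kappa> v = (if v \<in> P then dominating_weight n else - dominating_weight n)" for v
  obtain p' m' where in0: "inertia n (forest_matrix n \<kappa>) p' m'"
    and bounds: "p' \<le> n - card W + card P" "m' \<le> n - card W + card (nonroots - P)"
    using forest_matrix_inertia[OF W(1) P(1) \<kappa>_def] by blast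
  have rs: "k \<le> nat r" "k \<le> nat s" "nat r + nat s + num_components F = n + k"
    "k \<le> num_components F" "k \<le> n"
    using assms(2-6) c by auto
  have "n - card W = k" using W(3) rs(5) by simp
  then have "p' \<le> k + p" "m' \<le> k + (card nonroots - p)" using bounds P(2) cardN by simp_all
  moreover have "card nonroots + num_components F + k \<le> n" using nonroots rs(5) by linarith
  moreover have "p = nat r - k \<or> p = card nonroots" "p \<le> nat r - k" by (auto simp: p_def)
  ultimately have "p' \<le> nat r" "m' \<le> nat s" "nat r + nat s \<le> n"
    using rs by linarith+
  then obtain b where off: "same_off_diagonal n (forest_matrix n \<kappa>) b" and b: "inertia n b (nat r) (nat s)"
    using inertia_increase_diagonal[OF symmetric_forest_matrix in0] by blast
  have sym_b: "symmetric_on n b" by (rule same_off_diagonal_symmetric[OF symmetric_forest_matrix off])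
  have \<kappa>: "\<bar>\<kappa> v\<bar> > 1" for v
  proof -
    have "dominating_weight n \<ge> 2" by (simp add: dominating_weight_def)
    then show ?thesis by (simp add: \<kappa>_def)
  qed
  define A where "A = mat n n (\<lambda>(i, j). b i j)"
  have "A \<in> sym_matrices G"
    using sym_b off forest_matrix_pattern[OF \<kappa>] vG
    by (auto simp: sym_matrices_def A_def symmetric_on_def same_off_diagonal_def)
  moreover have "pin A = (nat r, nat s)"
  proof -
    obtain q d where qd: "eigenbasis n b q d"
      and rs: "card {t. t < n \<and> d t > 0} = nat r" "card {t. t < n \<and> d t < 0} = nat s"
      using b by (auto simp: inertia_def)
    have "eigenbasis n (\<lambda>i j. A $$ (i, j)) q d"
      using qd by (simp add: eigenbasis_def act_def A_def)
    then show ?thesis using pin_eigenbasis[of A n q d] rs by (simp add: A_def)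
  qed
  ultimately show ?thesis by blast
qed

end
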